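(* Let $G=(V,w,m)$ be a graph with $Ric(G)\ge K$ for some $K\in\mathbb R$. Then, for all $x\neq y$, $$\kappa(x,y)=\lim_{t\to0^+}\frac1t\left(1-\frac{W(p_x^t,p_y^t)}{d(x,y)}\right).$$
   Context: A graph is a triple $G=(V,w,m)$ with $V$ a countable set, $w:V\times V\to[0,\infty)$ symmetric and zero on the diagonal, and $m:V\to(0,\infty)$. Write $x\sim y$ if $w(x,y)>0$. All graphs are locally finite (for each $x$ only finitely many $y$ satisfy $x\sim y$) and connected; $d(x,y)=\inf\{n: x=x_0\sim\cdots\sim x_n=y\}$ is the combinatorial distance, which is finite by connectedness. The Laplacian is $\Delta f(x)=\frac1{m(x)}\sum_{y\in V}w(x,y)(f(y)-f(x))$, and $\mathrm{Deg}(x)=\frac1{m(x)}\sum_{y}w(x,y)$. $Lip(1)$ is the set of $f:V\to\mathbb R$ with $|f(x)-f(y)|\le d(x,y)$ for all $x,y$. Heat semigroup: for non-negative bounded $f:V\to\mathbb R$, $P_tf(x)=u(x,t)$ is the smallest non-negative bounded continuous solution of $\partial_tu=\Delta u$ on $V\times[0,\infty)$, $u(\cdot,0)=f$. The heat kernel measure is $p_x^t(y)=P_t1_y(x)=\frac{m(y)}{m(x)}P_t1_x(y)$. Wasserstein distance: for measures $\mu,\nu$ on $V$ of finite mass, $W(\mu,\nu)=\sup_{f}\sum_{x}f(x)(\mu(x)-\nu(x))$, the supremum over bounded $f\in Lip(1)$. Curvature: for $x\in V$ and $\varepsilon>0$ let $m_x^\varepsilon(x)=1-\varepsilon\,\mathrm{Deg}(x)$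 and $m_x^\varepsilon(y)=\varepsilon w(x,y)/m(x)$ for $y\neq x$; this is a finitely supported probability measure for $\varepsilon$ small. For $x\neq y$ let $\kappa_\varepsilon(x,y)=1-\frac{W(m_x^\varepsilon,m_y^\varepsilon)}{d(x,y)}$ and $\kappa(x,y)=\lim_{\varepsilon\to0^+}\frac1\varepsilon\kappa_\varepsilon(x,y)$ (this limit exists). $Ric(G)\ge K$ means $\kappa(x,y)\ge K$ for all $x\ne y$. *)

theory Defs
  imports "HOL-Analysis.Analysis"
begin

text \<open>The vertex set is the (countable) type \<open>'v\<close>. Measures on it are given by their point
  masses \<open>'v \<Rightarrow> real\<close>.\<close>

definition adj :: "('v \<Rightarrow> 'v \<Rightarrow> real) \<Rightarrow> 'v \<Rightarrow> 'v \<Rightarrow> bool" where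
  "adj w x y \<longleftrightarrow> w x y > 0"

locale weighted_graph =
  fixes w :: "'v::countable \<Rightarrow> 'v \<Rightarrow> real" and m :: "'v \<Rightarrow> real"
  assumes w_nonneg: "w x y \<ge> 0"
    and w_sym: "w x y = w y x"
    and w_diag: "w x x = 0"
    and m_pos: "m x > 0"
    and locally_finite: "finite {y. adj w x y}"
    and connected: "(adj w)\<^sup>*\<^sup>* x y"

definition gdist :: "('v \<Rightarrow> 'v \<Rightarrow> real) \<Rightarrow> 'v \<Rightarrow> 'v \<Rightarrow> nat" where
  "gdist w x y = Inf {n. (adj w ^^ n) x y}"

text \<open>By local finiteness the sums in the next two definitions have finitely many nonzero terms.\<close>

definition laplacian :: "('v \<Rightarrow> 'v \<Rightarrow> real) \<Rightarrow> ('v \<Rightarrow> real) \<Rightarrow> ('v \<Rightarrow> real) \<Rightarrow> 'v \<Rightarrow> real" where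
  "laplacian w m f x = (1 / m x) * (\<Sum>\<^sub>\<infinity>y\<in>UNIV. w x y * (f y - f x))"

definition Deg :: "('v \<Rightarrow> 'v \<Rightarrow> real) \<Rightarrow> ('v \<Rightarrow> real) \<Rightarrow> 'v \<Rightarrow> real" where
  "Deg w m x = (1 / m x) * (\<Sum>\<^sub>\<infinity>y\<in>UNIV. w x y)"

definition Lip1 :: "('v \<Rightarrow> 'v \<Rightarrow> real) \<Rightarrow> ('v \<Rightarrow> real) set" where
  "Lip1 w = {f. \<forall>x y. \<bar>f x - f y\<bar> \<le> real (gdist w x y)}"

text \<open>The vertex set is discrete, so continuity on \<open>V \<times> [0,\<infinity>)\<close> is continuity in time at every
  vertex. The time derivative at \<open>t = 0\<close> is one-sided.\<close>

definition heat_solution ::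
  "('v \<Rightarrow> 'v \<Rightarrow> real) \<Rightarrow> ('v \<Rightarrow> real) \<Rightarrow> ('v \<Rightarrow> real) \<Rightarrow> ('v \<Rightarrow> real \<Rightarrow> real) \<Rightarrow> bool" where
  "heat_solution w m f u \<longleftrightarrow>
     (\<forall>x. \<forall>t\<ge>0. 0 \<le> u x t) \<and>
     (\<exists>C. \<forall>x. \<forall>t\<ge>0. u x t \<le> C) \<and>
     (\<forall>x. continuous_on {0..} (u x)) \<and>
     (\<forall>x. \<forall>t\<ge>0. (u x has_real_derivative laplacian w m (\<lambda>y. u y t) x) (at t within {0..})) \<and>
     (\<forall>x. u x 0 = f x)"

definition least_heat_solution ::
  "('v \<Rightarrow> 'v \<Rightarrow> real) \<Rightarrow> ('v \<Rightarrow> real) \<Rightarrow> ('v \<Rightarrow> real) \<Rightarrow> ('v \<Rightarrow> real \<Rightarrow> real) \<Rightarrow> bool" where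
  "least_heat_solution w m f u \<longleftrightarrow> heat_solution w m f u \<and>
     (\<forall>v. heat_solution w m f v \<longrightarrow> (\<forall>x. \<forall>t\<ge>0. u x t \<le> v x t))"

text \<open>A least solution is unique for \<open>t \<ge> 0\<close>; only its values at negative times, which are
  irrelevant, depend on the choice made by \<open>SOME\<close>.\<close>

definition heat_semigroup ::
  "('v \<Rightarrow> 'v \<Rightarrow> real) \<Rightarrow> ('v \<Rightarrow> real) \<Rightarrow> real \<Rightarrow> ('v \<Rightarrow> real) \<Rightarrow> 'v \<Rightarrow> real" where
  "heat_semigroup w m t f x = (SOME u. least_heat_solution w m f u) x t"

definition heat_kernel ::
  "('v \<Rightarrow> 'v \<Rightarrow> real) \<Rightarrow> ('v \<Rightarrow> real) \<Rightarrow> real \<Rightarrow> 'v \<Rightarrow> 'v \<Rightarrow> real" where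
  "heat_kernel w m t x y = heat_semigroup w m t (indicator {y}) x"

text \<open>The supremum is taken in the extended reals since it may be infinite, for instance for
  measures of different total mass.\<close>

definition wasserstein ::
  "('v \<Rightarrow> 'v \<Rightarrow> real) \<Rightarrow> ('v \<Rightarrow> real) \<Rightarrow> ('v \<Rightarrow> real) \<Rightarrow> ereal" where
  "wasserstein w \<mu> \<nu> =
     (SUP f \<in> {f \<in> Lip1 w. bounded (range f)}. ereal (\<Sum>\<^sub>\<infinity>x\<in>UNIV. f x * (\<mu> x - \<nu> x)))"

definition walk_measure ::
  "('v \<Rightarrow> 'v \<Rightarrow> real) \<Rightarrow> ('v \<Rightarrow> real) \<Rightarrow> real \<Rightarrow> 'v \<Rightarrow> 'v \<Rightarrow> real" where
  "walk_measure w m \<epsilon> x y = (if y = x then 1 - \<epsilon> * Deg w m x else \<epsilon> * w x y / m x)"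

definition curvature_eps ::
  "('v \<Rightarrow> 'v \<Rightarrow> real) \<Rightarrow> ('v \<Rightarrow> real) \<Rightarrow> real \<Rightarrow> 'v \<Rightarrow> 'v \<Rightarrow> ereal" where
  "curvature_eps w m \<epsilon> x y =
     1 - wasserstein w (walk_measure w m \<epsilon> x) (walk_measure w m \<epsilon> y) / ereal (real (gdist w x y))"

text \<open>For \<open>x \<noteq> y\<close> the limit exists and is finite, so \<open>real_of_ereal\<close> only changes the type.\<close>

definition curvature ::
  "('v \<Rightarrow> 'v \<Rightarrow> real) \<Rightarrow> ('v \<Rightarrow> real) \<Rightarrow> 'v \<Rightarrow> 'v \<Rightarrow> real" where
  "curvature w m x y =
     real_of_ereal (Lim (at_right 0) (\<lambda>\<epsilon>. ereal (1 / \<epsilon>) * curvature_eps w m \<epsilon> x y))"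

definition Ric_ge :: "('v \<Rightarrow> 'v \<Rightarrow> real) \<Rightarrow> ('v \<Rightarrow> real) \<Rightarrow> real \<Rightarrow> bool" where
  "Ric_ge w m K \<longleftrightarrow> (\<forall>x y. x \<noteq> y \<longrightarrow> curvature w m x y \<ge> K)"

end

theory Submission
  imports Defs
begin

text \<open>
  For Lipschitz \<open>f\<close> one has \<open>P\<^sub>t f = f + t \<Delta>f + O(t\<^sup>2)\<close> at every vertex, uniformly over all
  bounded \<open>f\<close> in \<open>Lip1\<close>. By duality the Wasserstein distances of the heat kernels and of the
  \<open>t\<close>-lazy walks therefore differ by \<open>O(t\<^sup>2)\<close>, and the claim is the definition of the curvature.
  The uniformity comes from the gradient bound \<open>Lip(P\<^sub>t f) \<le> exp (- K t) Lip(f)\<close>. This follows from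
  a maximum principle on pairs of vertices, localised by the barrier \<open>1 + d(\<cdot>, r)\<close>: by Laplacian
  comparison the barrier satisfies \<open>\<Delta>\<rho> < \<lambda> \<rho>\<close>, and its sublevel sets are finite. The same barrier
  gives uniqueness of bounded solutions and conservation of mass, without which the
  Wasserstein distance of the heat kernels could be infinite.
\<close>

section \<open>Parabolic maximum principle\<close>

text \<open>A positive value would force a positive maximum over the finite set \<open>F\<close> and
  the times \<open>{0..t}\<close>, attained after time 0. By \<open>max\<close> the time derivative
  there is negative, so the same component was larger slightly earlier.\<close>

lemma parabolic_maximum_principle:
  fixes G :: "'i \<Rightarrow> real \<Rightarrow> real"
  assumes "finite F"
    and outside: "\<And>i t. i \<notin> F \<Longrightarrow> 0 \<le> t \<Longrightarrow> G i t \<le> 0"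
    and init: "\<And>i. G i 0 \<le> 0"
    and deriv: "\<And>i t. 0 \<le> t \<Longrightarrow> (G i has_real_derivative G' i t) (at t within {0..})"
    and max: "\<And>i t. 0 < t \<Longrightarrow> G i t > 0 \<Longrightarrow> (\<And>j. G j t \<le> G i t) \<Longrightarrow> G' i t < 0"
    and "0 \<le> t"
  shows "G i t \<le> 0"
proof (rule ccontr)
  assume "\<not> G i t \<le> 0"
  then have pos: "G i t > 0" by simp
  have cont: "continuous_on {0..t} (G j)" for j
    using deriv DERIV_subset[of "G j" _ _ "{0..}" "{0..t}"]
    by (intro DERIV_continuous_on[where D = "G' j"]) auto
  have "\<exists>s\<in>{0..t}. \<forall>r\<in>{0..t}. G j r \<le> G j s" for j
    using cont[of j] \<open>0 \<le> t\<close> by (intro continuous_attains_sup) auto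
  then obtain \<tau> where \<tau>: "\<And>j. \<tau> j \<in> {0..t}" "\<And>j r. r \<in> {0..t} \<Longrightarrow> G j r \<le> G j (\<tau> j)"
    by metis
  have "i \<in> F" using outside pos \<open>0 \<le> t\<close> by (metis not_le)
  define A where "A = (\<lambda>j. G j (\<tau> j)) ` F"
  have "Max A \<in> A" unfolding A_def using \<open>finite F\<close> \<open>i \<in> F\<close> by (intro Max_in) auto
  then obtain j where j: "j \<in> F" "G j (\<tau> j) = Max A" unfolding A_def by auto
  have le_F: "G k r \<le> G j (\<tau> j)" if "k \<in> F" "r \<in> {0..t}" for k r
  proof -
    have "G k (\<tau> k) \<le> Max A" using \<open>finite F\<close> that unfolding A_def by (intro Max_ge) auto
    then show ?thesis using \<tau>(2)[OF that(2), of k] j by linarith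
  qed
  have jpos: "G j (\<tau> j) > 0"
    using le_F[OF \<open>i \<in> F\<close>, of t] pos \<open>0 \<le> t\<close> by simp
  \<comment> \<open>Components outside \<open>F\<close> are nonpositive, so the positive maximum
    over \<open>F\<close> is a maximum over all indices.\<close>
  have le: "G k r \<le> G j (\<tau> j)" if "r \<in> {0..t}" for k r
    using le_F[of k r] outside[of k r] jpos that by (cases "k \<in> F") auto
  have "\<tau> j > 0" using jpos init[of j] \<tau>(1)[of j] by (cases "\<tau> j = 0") auto
  then have neg: "G' j (\<tau> j) < 0" using max jpos le \<tau>(1) by blast
  have "(G j has_real_derivative G' j (\<tau> j)) (at (\<tau> j) within {0..})"
    using deriv[of "\<tau> j" j] \<open>\<tau> j > 0\<close> by simp
  then have "(G j has_real_derivative G' j (\<tau> j)) (at (\<tau> j))"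
    using at_within_interior[of "\<tau> j" "{0..}"] \<open>\<tau> j > 0\<close> by simp
  from DERIV_neg_dec_left[OF this neg] obtain e where
    e: "e > 0" "\<And>h. 0 < h \<Longrightarrow> h < e \<Longrightarrow> G j (\<tau> j) < G j (\<tau> j - h)" by blast
  \<comment> \<open>The step back in time has to be shorter than \<open>e\<close> and must not pass
    time 0.\<close>
  define h where "h = min (e / 2) (\<tau> j)"
  have "h > 0" "h < e" "\<tau> j - h \<in> {0..t}"
    using e(1) \<open>\<tau> j > 0\<close> \<tau>(1)[of j] unfolding h_def by auto
  then show False using e(2)[of h] \<tau>(2)[of "\<tau> j - h" j] by simp
qed

section \<open>Graph Laplacian and combinatorial distance\<close>

context weighted_graph
begin

definition nbrs :: "'v \<Rightarrow> 'v set" where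
  "nbrs x = {y. adj w x y}"

lemma finite_nbrs [simp]: "finite (nbrs x)"
  unfolding nbrs_def by (rule locally_finite)

lemma self_notin_nbrs [simp]: "x \<notin> nbrs x"
  by (simp add: nbrs_def adj_def w_diag)

lemma w_eq_0: "y \<notin> nbrs x \<Longrightarrow> w x y = 0"
  using w_nonneg[of x y] unfolding nbrs_def adj_def by auto

lemma laplacian_eq: "laplacian w m f x = (\<Sum>y\<in>nbrs x. w x y * (f y - f x)) / m x"
proof -
  have "(\<Sum>\<^sub>\<infinity>y\<in>UNIV. w x y * (f y - f x)) = (\<Sum>\<^sub>\<infinity>y\<in>nbrs x. w x y * (f y - f x))"
    by (rule infsum_cong_neutral) (auto simp: w_eq_0)
  then show ?thesis by (simp add: laplacian_def)
qed

lemma Deg_eq: "Deg w m x = (\<Sum>y\<in>nbrs x. w x y) / m x"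
proof -
  have "(\<Sum>\<^sub>\<infinity>y\<in>UNIV. w x y) = (\<Sum>\<^sub>\<infinity>y\<in>nbrs x. w x y)"
    by (rule infsum_cong_neutral) (auto simp: w_eq_0)
  then show ?thesis by (simp add: Deg_def)
qed

lemma Deg_nonneg: "Deg w m x \<ge> 0"
  unfolding Deg_eq using w_nonneg m_pos[of x] by (intro divide_nonneg_pos sum_nonneg) auto

lemma laplacian_diff:
  "laplacian w m (\<lambda>z. f z - g z) x = laplacian w m f x - laplacian w m g x"
  by (simp add: laplacian_eq diff_divide_distrib[symmetric] sum_subtractf[symmetric] algebra_simps)

lemma laplacian_add:
  "laplacian w m (\<lambda>z. f z + g z) x = laplacian w m f x + laplacian w m g x"
  by (simp add: laplacian_eq add_divide_distrib[symmetric] sum.distrib[symmetric] algebra_simps)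

lemma laplacian_cmult: "laplacian w m (\<lambda>z. c * f z) x = c * laplacian w m f x"
  by (simp add: laplacian_eq sum_distrib_left algebra_simps)

lemma laplacian_const [simp]: "laplacian w m (\<lambda>z. c) x = 0"
  by (simp add: laplacian_eq)

lemma laplacian_cong:
  assumes "\<And>y. y \<in> nbrs x \<Longrightarrow> f y = g y" "f x = g x"
  shows "laplacian w m f x = laplacian w m g x"
  unfolding laplacian_eq using assms by (intro arg_cong2[where f = "(/)"] sum.cong) auto

lemma laplacian_mono:
  assumes "\<And>y. f y - f x \<le> g y - g x"
  shows "laplacian w m f x \<le> laplacian w m g x"
  unfolding laplacian_eq using assms w_nonneg m_pos[of x]
  by (intro divide_right_mono sum_mono mult_left_mono) auto

lemma laplacian_abs_le:
  assumes "\<And>y. y \<in> nbrs x \<Longrightarrow> \<bar>f y - f x\<bar> \<le> c y"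
  shows "\<bar>laplacian w m f x\<bar> \<le> (\<Sum>y\<in>nbrs x. w x y * c y) / m x"
proof -
  have "\<bar>\<Sum>y\<in>nbrs x. w x y * (f y - f x)\<bar> \<le> (\<Sum>y\<in>nbrs x. w x y * c y)"
    using assms w_nonneg
    by (intro order_trans[OF sum_abs] sum_mono) (auto simp: abs_mult intro: mult_left_mono)
  then show ?thesis using m_pos[of x] by (simp add: laplacian_eq divide_right_mono)
qed

lemma gdist_path: "(adj w ^^ gdist w x y) x y"
proof -
  have "{n. (adj w ^^ n) x y} \<noteq> {}"
    using connected[of x y] by (auto simp: rtranclp_power)
  then show ?thesis unfolding gdist_def using Inf_nat_def1[of "{n. (adj w ^^ n) x y}"] by simp
qed

lemma gdist_le: "(adj w ^^ n) x y \<Longrightarrow> gdist w x y \<le> n"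
  unfolding gdist_def by (rule wellorder_Inf_le1) simp

lemma gdist_self [simp]: "gdist w x x = 0"
  using gdist_le[of 0 x x] by simp

lemma gdist_pos: "x \<noteq> y \<Longrightarrow> gdist w x y > 0"
  using gdist_path[of x y] by (cases "gdist w x y") auto

lemma gdist_triangle: "gdist w x z \<le> gdist w x y + gdist w y z"
  by (rule gdist_le) (use gdist_path[of x y] gdist_path[of y z] in \<open>auto simp: relpowp_add\<close>)

lemma adj_sym: "adj w x y \<longleftrightarrow> adj w y x"
  by (simp add: adj_def w_sym)

lemma gdist_sym: "gdist w x y = gdist w y x"
proof -
  have "(adj w ^^ n) x y \<Longrightarrow> (adj w ^^ n) y x" for n x y
  proof (induction n arbitrary: y)
    case (Suc n)
    from Suc.prems obtain z where "(adj w ^^ n) x z" "adj w z y" by (rule relpowp_Suc_E)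
    then show ?case using Suc.IH adj_sym relpowp_Suc_I2 by metis
  qed simp
  then show ?thesis by (metis gdist_le gdist_path order_antisym)
qed

lemma gdist_nbr: "y \<in> nbrs x \<Longrightarrow> gdist w x y \<le> 1"
  using gdist_le[of 1 x y] by (simp only: relpowp_1 nbrs_def mem_Collect_eq)

text \<open>By local finiteness the set of endpoints of paths of length \<open>k\<close> stays
  finite from one \<open>k\<close> to the next. This later makes the sublevel sets of the barrier
  finite.\<close>

lemma finite_gdist_ball: "finite {y. gdist w x y \<le> n}"
proof -
  have path: "finite {y. (adj w ^^ k) x y}" for k
  proof (induction k)
    case (Suc k)
    have "{y. (adj w ^^ Suc k) x y} \<subseteq> (\<Union>z\<in>{z. (adj w ^^ k) x z}. nbrs z)"
      by (auto simp: nbrs_def)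
    then show ?case by (rule finite_subset) (use Suc in auto)
  qed simp
  have "{y. gdist w x y \<le> n} \<subseteq> (\<Union>k\<in>{..n}. {y. (adj w ^^ k) x y})"
    using gdist_path by auto
  then show ?thesis by (rule finite_subset) (auto simp: path)
qed

lemma Lip1_I: "(\<And>x y. f x - f y \<le> real (gdist w x y)) \<Longrightarrow> f \<in> Lip1 w"
  unfolding Lip1_def abs_le_iff by (simp, metis gdist_sym)

lemma Lip1_D: "f \<in> Lip1 w \<Longrightarrow> \<bar>f x - f y\<bar> \<le> real (gdist w x y)"
  unfolding Lip1_def by simp

lemma Lip1_D': "f \<in> Lip1 w \<Longrightarrow> f x - f y \<le> real (gdist w x y)"
  using Lip1_D[of f x y] by linarith

lemma gdist_Lip1: "(\<lambda>z. real (gdist w z y)) \<in> Lip1 w"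
proof (rule Lip1_I)
  fix a b
  show "real (gdist w a y) - real (gdist w b y) \<le> real (gdist w a b)"
    using gdist_triangle[of a y b] by linarith
qed

lemma laplacian_lipschitz:
  assumes "\<And>y z. \<bar>f y - f z\<bar> \<le> c * real (gdist w y z)"
  shows "\<bar>laplacian w m f x\<bar> \<le> c * Deg w m x"
proof -
  have "\<bar>f y - f x\<bar> \<le> c" if "y \<in> nbrs x" for y
  proof -
    have "real (gdist w y x) \<le> 1" using gdist_nbr[OF that] by (simp add: gdist_sym)
    moreover have "real (gdist w y x) \<noteq> 0"
      using that gdist_pos[of y x] by (cases "y = x") auto
    ultimately have "gdist w y x = 1" by linarith
    then show ?thesis using assms[of y x] by simp
  qed
  then have "\<bar>laplacian w m f x\<bar> \<le> (\<Sum>y\<in>nbrs x. w x y * c) / m x"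
    by (rule laplacian_abs_le)
  then show ?thesis by (simp add: Deg_eq sum_distrib_left mult.commute)
qed

lemma laplacian_Lip1: "f \<in> Lip1 w \<Longrightarrow> \<bar>laplacian w m f x\<bar> \<le> Deg w m x"
  using laplacian_lipschitz[of f 1 x] Lip1_D[of f] by simp

text \<open>The walk measure is an explicit Euler step: it integrates \<open>f\<close> to
  \<open>f x + \<epsilon> * laplacian w m f x\<close>. Each test function thus contributes an affine
  function of \<open>\<epsilon>\<close>.\<close>

lemma infsum_walk_measure:
  "(\<Sum>\<^sub>\<infinity>z\<in>UNIV. f z * (walk_measure w m \<epsilon> x z - walk_measure w m \<epsilon> y z))
    = f x - f y + \<epsilon> * (laplacian w m f x - laplacian w m f y)"
proof -
  have *: "((\<lambda>z. f z * walk_measure w m \<epsilon> x z) has_sum (f x + \<epsilon> * laplacian w m f x)) UNIV" for x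
  proof -
    have "(\<Sum>z\<in>insert x (nbrs x). f z * walk_measure w m \<epsilon> x z)
        = f x * (1 - \<epsilon> * Deg w m x) + (\<Sum>z\<in>nbrs x. f z * walk_measure w m \<epsilon> x z)"
      by (simp add: walk_measure_def)
    also have "(\<Sum>z\<in>nbrs x. f z * walk_measure w m \<epsilon> x z) = (\<Sum>z\<in>nbrs x. \<epsilon> * (w x z * f z) / m x)"
      by (intro sum.cong) (auto simp: walk_measure_def)
    also have "f x * (1 - \<epsilon> * Deg w m x) + (\<Sum>z\<in>nbrs x. \<epsilon> * (w x z * f z) / m x)
        = f x + \<epsilon> * laplacian w m f x"
      by (simp add: laplacian_eq Deg_eq sum_divide_distrib sum_distrib_left sum_distrib_right
          sum_subtractf diff_divide_distrib algebra_simps)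
    finally have "((\<lambda>z. f z * walk_measure w m \<epsilon> x z) has_sum (f x + \<epsilon> * laplacian w m f x))
        (insert x (nbrs x))"
      by (metis finite_insert finite_nbrs has_sum_finite)
    then show ?thesis
      by (rule has_sum_cong_neutral[THEN iffD1, rotated -1])
        (auto simp: walk_measure_def w_eq_0)
  qed
  show ?thesis
    using has_sum_add[OF *[of x] has_sum_uminusI[OF *[of y]]]
    by (intro infsumI) (simp add: algebra_simps)
qed

subsection \<open>Lazy walks and curvature\<close>

definition bounded_Lip1 :: "('v \<Rightarrow> real) set" where
  "bounded_Lip1 = {f \<in> Lip1 w. bounded (range f)}"

text \<open>The real-valued form of the Wasserstein distance of two walk measures for
  \<open>\<epsilon> \<ge> 0\<close>, so that limits can be taken in the reals.\<close>

definition walk_cost :: "'v \<Rightarrow> 'v \<Rightarrow> real \<Rightarrow> real" where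
  "walk_cost x y \<epsilon> = (SUP f\<in>bounded_Lip1. f x - f y + \<epsilon> * (laplacian w m f x - laplacian w m f y))"

lemma laplacian_diff_le:
  assumes "f \<in> Lip1 w"
  shows "\<bar>laplacian w m f x - laplacian w m f y\<bar> \<le> Deg w m x + Deg w m y"
  using laplacian_Lip1[OF assms, of x] laplacian_Lip1[OF assms, of y] by linarith

lemma bdd_above_walk_cost:
  assumes "\<epsilon> \<ge> 0"
  shows "bdd_above ((\<lambda>f. f x - f y + \<epsilon> * (laplacian w m f x - laplacian w m f y)) ` bounded_Lip1)"
proof (rule bdd_aboveI2)
  fix f assume "f \<in> bounded_Lip1"
  then have f: "f \<in> Lip1 w" by (simp add: bounded_Lip1_def)
  show "f x - f y + \<epsilon> * (laplacian w m f x - laplacian w m f y)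
      \<le> real (gdist w x y) + \<epsilon> * (Deg w m x + Deg w m y)"
    using Lip1_D'[OF f, of x y] laplacian_diff_le[OF f, of x y] assms
    by (intro add_mono mult_left_mono) auto
qed

lemma walk_cost_ge:
  assumes "\<epsilon> \<ge> 0" "f \<in> bounded_Lip1"
  shows "f x - f y + \<epsilon> * (laplacian w m f x - laplacian w m f y) \<le> walk_cost x y \<epsilon>"
  unfolding walk_cost_def using assms by (intro cSUP_upper bdd_above_walk_cost)

lemma zero_bounded_Lip1: "(\<lambda>_. 0) \<in> bounded_Lip1"
  unfolding bounded_Lip1_def by (auto intro: Lip1_I)

lemma wasserstein_walk:
  assumes "\<epsilon> \<ge> 0"
  shows "wasserstein w (walk_measure w m \<epsilon> x) (walk_measure w m \<epsilon> y) = ereal (walk_cost x y \<epsilon>)"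
proof -
  have "wasserstein w (walk_measure w m \<epsilon> x) (walk_measure w m \<epsilon> y)
      = (SUP f\<in>bounded_Lip1. ereal (f x - f y + \<epsilon> * (laplacian w m f x - laplacian w m f y)))"
    unfolding wasserstein_def bounded_Lip1_def infsum_walk_measure ..
  also have "\<dots> = ereal (walk_cost x y \<epsilon>)"
    unfolding walk_cost_def
  proof (rule ereal_SUP[symmetric])
    have "(SUP f\<in>bounded_Lip1. ereal (f x - f y + \<epsilon> * (laplacian w m f x - laplacian w m f y)))
        \<le> ereal (walk_cost x y \<epsilon>)"
      using walk_cost_ge[OF assms] by (intro SUP_least) auto
    moreover have "ereal 0 \<le> (SUP f\<in>bounded_Lip1. ereal (f x - f y + \<epsilon> * (laplacian w m f x - laplacian w m f y)))"
      by (rule SUP_upper2[OF zero_bounded_Lip1]) simp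
    ultimately show "\<bar>SUP f\<in>bounded_Lip1. ereal (f x - f y + \<epsilon> * (laplacian w m f x - laplacian w m f y))\<bar> \<noteq> \<infinity>"
      by auto
  qed
  finally show ?thesis .
qed

lemma Lip1_truncate:
  assumes "f \<in> Lip1 w"
  shows "(\<lambda>z. max (- R) (min R (f z))) \<in> bounded_Lip1"
proof -
  have "(\<lambda>z. max (- R) (min R (f z))) \<in> Lip1 w"
  proof (rule Lip1_I)
    fix a b
    show "max (- R) (min R (f a)) - max (- R) (min R (f b)) \<le> real (gdist w a b)"
      using Lip1_D'[OF assms, of a b] by (auto simp: max_def min_def)
  qed
  moreover have "bounded (range (\<lambda>z. max (- R) (min R (f z))))"
    unfolding bounded_iff by (rule exI[of _ "\<bar>R\<bar>"]) auto
  ultimately show ?thesis by (simp add: bounded_Lip1_def)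
qed

text \<open>Only the values of \<open>f\<close> at \<open>x\<close>, \<open>y\<close> and their
  neighbours enter, so truncation at a level above all of them changes nothing. This admits distance
  functions, which may be unbounded, as test functions.\<close>

lemma walk_cost_ge_Lip1:
  assumes "\<epsilon> \<ge> 0" "f \<in> Lip1 w"
  shows "f x - f y + \<epsilon> * (laplacian w m f x - laplacian w m f y) \<le> walk_cost x y \<epsilon>"
proof -
  let ?F = "nbrs x \<union> nbrs y \<union> {x, y}"
  have "finite ?F" by simp
  then obtain R where R: "\<And>z. z \<in> ?F \<Longrightarrow> \<bar>f z\<bar> \<le> R"
    using bounded_iff[of "f ` ?F"] finite_imp_bounded[of "f ` ?F"] by auto
  let ?g = "\<lambda>z. max (- R) (min R (f z))"
  have g: "?g z = f z" if "z \<in> ?F" for z using R[OF that] by auto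
  have "laplacian w m ?g x = laplacian w m f x" "laplacian w m ?g y = laplacian w m f y"
    by (rule laplacian_cong; use g in blast)+
  then show ?thesis
    using walk_cost_ge[OF assms(1) Lip1_truncate[OF assms(2)], of R x y] g by simp
qed

text \<open>For a single \<open>f\<close> the slope is \<open>(f x - f y - d) / \<epsilon>\<close>,
  with \<open>d\<close> the distance, plus a term independent of \<open>\<epsilon>\<close>. Since
  \<open>f x - f y \<le> d\<close>, it is nondecreasing in \<open>\<epsilon>\<close>, and the
  supremum inherits this.\<close>

lemma walk_cost_slope_mono:
  assumes "0 < \<epsilon>" "\<epsilon> \<le> \<delta>"
  shows "(walk_cost x y \<epsilon> - real (gdist w x y)) / \<epsilon> \<le> (walk_cost x y \<delta> - real (gdist w x y)) / \<delta>"
proof -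
  let ?d = "real (gdist w x y)" and ?s = "(walk_cost x y \<delta> - real (gdist w x y)) / \<delta>"
  have "walk_cost x y \<epsilon> \<le> ?d + \<epsilon> * ?s"
    unfolding walk_cost_def[of x y \<epsilon>]
  proof (rule cSUP_least)
    fix f assume f: "f \<in> bounded_Lip1"
    let ?A = "f x - f y" and ?B = "laplacian w m f x - laplacian w m f y"
    have "?A \<le> ?d" using f Lip1_D'[of f x y] by (simp add: bounded_Lip1_def)
    then have "(?A - ?d) * \<delta> \<le> (?A - ?d) * \<epsilon>" using assms by (intro mult_left_mono_neg) auto
    moreover have "\<epsilon> * (?A + \<delta> * ?B - ?d) \<le> \<epsilon> * (walk_cost x y \<delta> - ?d)"
      using walk_cost_ge[OF _ f, of \<delta> x y] assms by (intro mult_left_mono) auto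
    ultimately have "\<delta> * (?A + \<epsilon> * ?B - ?d) \<le> \<epsilon> * (walk_cost x y \<delta> - ?d)"
      by (simp add: algebra_simps)
    then show "?A + \<epsilon> * ?B \<le> ?d + \<epsilon> * ?s"
      using assms by (simp add: field_simps)
  qed (use zero_bounded_Lip1 in blast)
  then show ?thesis using assms by (simp add: field_simps)
qed

lemma curvature_eps_eq:
  assumes "\<epsilon> > 0" "x \<noteq> y"
  shows "ereal (1 / \<epsilon>) * curvature_eps w m \<epsilon> x y
    = ereal ((1 - walk_cost x y \<epsilon> / real (gdist w x y)) / \<epsilon>)"
  using assms gdist_pos[of x y] by (simp add: curvature_eps_def wasserstein_walk one_ereal_def)

text \<open>The quotients grow as \<open>\<epsilon>\<close> decreases and are bounded above, so they
  converge to their supremum. In particular the \<open>Lim\<close> in the definition of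
  \<open>curvature\<close> is a genuine limit.\<close>

lemma walk_cost_tendsto_curvature:
  assumes "x \<noteq> y"
  shows "((\<lambda>\<epsilon>. (1 - walk_cost x y \<epsilon> / real (gdist w x y)) / \<epsilon>) \<longlongrightarrow> curvature w m x y) (at_right 0)"
proof -
  define d where "d = real (gdist w x y)"
  have d: "d > 0" using gdist_pos[OF assms] by (simp add: d_def)
  define q where "q \<epsilon> = (1 - walk_cost x y \<epsilon> / d) / \<epsilon>" for \<epsilon>
  have q_eq: "q \<epsilon> = - ((walk_cost x y \<epsilon> - d) / \<epsilon>) / d" for \<epsilon>
  proof -
    have "1 - walk_cost x y \<epsilon> / d = - (walk_cost x y \<epsilon> - d) / d"
      using d by (simp add: field_simps)
    then show ?thesis by (simp add: q_def minus_divide_left)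
  qed
  have anti: "q \<delta> \<le> q \<epsilon>" if "0 < \<epsilon>" "\<epsilon> \<le> \<delta>" for \<epsilon> \<delta>
    unfolding q_eq using walk_cost_slope_mono[OF that, of x y] d
    by (intro divide_right_mono) (auto simp: d_def)
  let ?f = "\<lambda>z. real (gdist w z y)"
  \<comment> \<open>Testing with the distance to \<open>y\<close> bounds \<open>walk_cost\<close>
    from below: its increment from \<open>y\<close> to \<open>x\<close> is the full distance, and
    its Laplacians are controlled by the degrees.\<close>
  have ub: "q \<epsilon> \<le> (Deg w m x + Deg w m y) / d" if "\<epsilon> > 0" for \<epsilon>
  proof -
    have "d + \<epsilon> * - (Deg w m x + Deg w m y) \<le> ?f x - ?f y + \<epsilon> * (laplacian w m ?f x - laplacian w m ?f y)"
      using laplacian_diff_le[OF gdist_Lip1, of y x y] that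
      by (intro add_mono mult_left_mono) (auto simp: d_def)
    also have "\<dots> \<le> walk_cost x y \<epsilon>" using that by (intro walk_cost_ge_Lip1 gdist_Lip1) simp
    finally have "- ((walk_cost x y \<epsilon> - d) / \<epsilon>) \<le> Deg w m x + Deg w m y"
      using that by (simp add: field_simps)
    then show ?thesis unfolding q_eq using d by (intro divide_right_mono) auto
  qed
  define c where "c = (SUP \<epsilon>\<in>{0<..}. q \<epsilon>)"
  have bdd: "bdd_above (q ` {0<..})" using ub by (intro bdd_aboveI2) auto
  have lim: "(q \<longlongrightarrow> c) (at_right 0)"
  proof (rule order_tendstoI)
    fix a assume "a < c"
    then obtain \<delta> where \<delta>: "\<delta> > 0" "a < q \<delta>"
      unfolding c_def using less_cSUP_iff[OF _ bdd] by auto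
    have "\<forall>\<^sub>F \<epsilon> in at_right 0. \<epsilon> \<in> {0<..<\<delta>}"
      using \<delta>(1) by (rule eventually_at_right_real)
    then show "\<forall>\<^sub>F \<epsilon> in at_right 0. a < q \<epsilon>"
    proof eventually_elim
      case (elim \<epsilon>)
      then show ?case using \<delta>(2) anti[of \<epsilon> \<delta>] by auto
    qed
  next
    fix a assume "c < a"
    have "q \<epsilon> \<le> c" if "\<epsilon> > 0" for \<epsilon>
      unfolding c_def using that bdd by (intro cSUP_upper) auto
    then show "\<forall>\<^sub>F \<epsilon> in at_right 0. q \<epsilon> < a"
      using \<open>c < a\<close> eventually_at_right_less[of "0::real"]
      by (auto elim!: eventually_mono intro: le_less_trans)
  qed
  have "((\<lambda>\<epsilon>. ereal (1 / \<epsilon>) * curvature_eps w m \<epsilon> x y) \<longlongrightarrow> ereal c) (at_right 0)"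
  proof (rule Lim_transform_eventually)
    show "((\<lambda>\<epsilon>. ereal (q \<epsilon>)) \<longlongrightarrow> ereal c) (at_right 0)" using lim by simp
    show "\<forall>\<^sub>F \<epsilon> in at_right 0. ereal (q \<epsilon>) = ereal (1 / \<epsilon>) * curvature_eps w m \<epsilon> x y"
      using eventually_at_right_less[of "0::real"]
      by eventually_elim (simp add: curvature_eps_eq assms q_def d_def)
  qed
  then have "curvature w m x y = c"
    unfolding curvature_def by (subst tendsto_Lim) auto
  then show ?thesis using lim unfolding q_def d_def by simp
qed

text \<open>Such an \<open>f\<close> competes in every \<open>walk_cost x y \<epsilon>\<close>. The
  resulting bound on the difference quotient does not depend on \<open>\<epsilon>\<close>, so it
  survives the limit.\<close>

lemma curvature_le:
  assumes "x \<noteq> y" "f \<in> Lip1 w" "f x - f y = real (gdist w x y)"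
  shows "laplacian w m f x - laplacian w m f y \<le> - curvature w m x y * real (gdist w x y)"
proof -
  define d where "d = real (gdist w x y)"
  have d: "d > 0" using gdist_pos[OF assms(1)] by (simp add: d_def)
  let ?B = "laplacian w m f x - laplacian w m f y"
  have "\<forall>\<^sub>F \<epsilon> in at_right 0. (1 - walk_cost x y \<epsilon> / d) / \<epsilon> \<le> - ?B / d"
    using eventually_at_right_less[of "0::real"]
  proof eventually_elim
    case (elim \<epsilon>)
    have "d + \<epsilon> * ?B \<le> walk_cost x y \<epsilon>"
      using walk_cost_ge_Lip1[of \<epsilon> f x y] assms elim by (simp add: d_def)
    then have "(1 - walk_cost x y \<epsilon> / d) / \<epsilon> \<le> (1 - (d + \<epsilon> * ?B) / d) / \<epsilon>"
      using d elim by (intro divide_right_mono diff_left_mono) auto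
    also have "\<dots> = - ?B / d" using d elim by (simp add: add_divide_distrib diff_divide_distrib)
    finally show ?case .
  qed
  then have "curvature w m x y \<le> - ?B / d"
    using walk_cost_tendsto_curvature[OF assms(1)] unfolding d_def
    by (intro tendsto_upperbound) auto
  then show ?thesis using d by (simp add: field_simps d_def)
qed

subsection \<open>Bounded solutions of the heat equation\<close>

text \<open>Unlike \<open>heat_solution\<close> this allows both signs, so that bounded solutions
  form a vector space. Continuity in time comes with differentiability.\<close>

definition solution :: "('v \<Rightarrow> real) \<Rightarrow> ('v \<Rightarrow> real \<Rightarrow> real) \<Rightarrow> bool" where
  "solution f u \<longleftrightarrow>
     (\<exists>C. \<forall>x. \<forall>t\<ge>0. \<bar>u x t\<bar> \<le> C) \<and>
     (\<forall>x. \<forall>t\<ge>0. (u x has_real_derivative laplacian w m (\<lambda>y. u y t) x) (at t within {0..})) \<and>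
     (\<forall>x. u x 0 = f x)"

lemma solution_bound:
  assumes "solution f u"
  obtains C where "\<And>x t. 0 \<le> t \<Longrightarrow> \<bar>u x t\<bar> \<le> C"
  using assms unfolding solution_def by blast

lemma solution_deriv:
  "solution f u \<Longrightarrow> 0 \<le> t \<Longrightarrow>
    (u x has_real_derivative laplacian w m (\<lambda>y. u y t) x) (at t within {0..})"
  unfolding solution_def by blast

lemma solution_0: "solution f u \<Longrightarrow> u x 0 = f x"
  unfolding solution_def by blast

lemma solution_add:
  assumes "solution f u" "solution g v"
  shows "solution (\<lambda>x. f x + g x) (\<lambda>x t. u x t + v x t)"
proof -
  obtain C where C: "\<And>x t. 0 \<le> t \<Longrightarrow> \<bar>u x t\<bar> \<le> C" using solution_bound[OF assms(1)] by blast
  obtain D where D: "\<And>x t. 0 \<le> t \<Longrightarrow> \<bar>v x t\<bar> \<le> D" using solution_bound[OF assms(2)] by blast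
  have "\<bar>u x t + v x t\<bar> \<le> C + D" if "0 \<le> t" for x t
    using C[OF that, of x] D[OF that, of x] by linarith
  then have "\<exists>C. \<forall>x. \<forall>t\<ge>0. \<bar>u x t + v x t\<bar> \<le> C" by blast
  then show ?thesis
    using assms unfolding solution_def by (auto simp: laplacian_add intro!: DERIV_add)
qed

lemma solution_cmult:
  assumes "solution f u"
  shows "solution (\<lambda>x. c * f x) (\<lambda>x t. c * u x t)"
proof -
  obtain C where C: "\<And>x t. 0 \<le> t \<Longrightarrow> \<bar>u x t\<bar> \<le> C" using solution_bound[OF assms(1)] by blast
  have "\<bar>c * u x t\<bar> \<le> \<bar>c\<bar> * C" if "0 \<le> t" for x t
    using C[OF that, of x] by (simp add: abs_mult mult_left_mono)
  then have "\<exists>C. \<forall>x. \<forall>t\<ge>0. \<bar>c * u x t\<bar> \<le> C" by blast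
  then show ?thesis
    using assms unfolding solution_def by (auto simp: laplacian_cmult intro!: DERIV_cmult)
qed

lemma solution_diff:
  assumes "solution f u" "solution g v"
  shows "solution (\<lambda>x. f x - g x) (\<lambda>x t. u x t - v x t)"
  using solution_add[OF assms(1) solution_cmult[OF assms(2), of "-1"]] by simp

lemma solution_const: "solution (\<lambda>x. c) (\<lambda>x t. c)"
  unfolding solution_def by auto

lemma solution_sum:
  assumes "finite I" "\<And>i. i \<in> I \<Longrightarrow> solution (f i) (u i)"
  shows "solution (\<lambda>x. \<Sum>i\<in>I. f i x) (\<lambda>x t. \<Sum>i\<in>I. u i x t)"
  using assms by (induction I rule: finite_induct) (auto simp: solution_const intro: solution_add)

section \<open>Feller construction of bounded solutions\<close>

text \<open>The off-diagonal part of the Laplacian. It is monotone in \<open>g\<close>, while the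
  diagonal part, multiplication by \<open>- Deg w m x\<close>, is absorbed by an integrating
  factor.\<close>

definition nbr_sum :: "('v \<Rightarrow> real) \<Rightarrow> 'v \<Rightarrow> real" where
  "nbr_sum g x = (\<Sum>y\<in>nbrs x. w x y * g y) / m x"

lemma laplacian_nbr_sum: "laplacian w m g x = nbr_sum g x - Deg w m x * g x"
  by (simp add: laplacian_eq nbr_sum_def Deg_eq right_diff_distrib sum_subtractf
      diff_divide_distrib sum_distrib_right)

lemma nbr_sum_mono: "(\<And>y. g y \<le> h y) \<Longrightarrow> nbr_sum g x \<le> nbr_sum h x"
  unfolding nbr_sum_def using w_nonneg m_pos[of x]
  by (intro divide_right_mono sum_mono mult_left_mono) auto

lemma nbr_sum_const: "nbr_sum (\<lambda>y. c) x = Deg w m x * c"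
  by (simp add: nbr_sum_def Deg_eq sum_distrib_right)

lemma nbr_sum_tendsto:
  "(\<And>y. (\<lambda>n. g n y) \<longlonglongrightarrow> h y) \<Longrightarrow> (\<lambda>n. nbr_sum (g n) x) \<longlonglongrightarrow> nbr_sum h x"
  unfolding nbr_sum_def using m_pos[of x] by (intro tendsto_intros) auto

lemma nbr_sum_continuous:
  "(\<And>y. continuous_on S (g y)) \<Longrightarrow> continuous_on S (\<lambda>s. nbr_sum (\<lambda>y. g y s) x)"
  unfolding nbr_sum_def using m_pos[of x] by (intro continuous_intros) auto

text \<open>Iteration of the Duhamel formula from 0. Probabilistically,
  \<open>picard f n x t\<close> is the expectation of \<open>f\<close> at time \<open>t\<close>
  restricted to random walk paths from \<open>x\<close> with fewer than \<open>n\<close>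
  jumps.\<close>

primrec picard :: "('v \<Rightarrow> real) \<Rightarrow> nat \<Rightarrow> 'v \<Rightarrow> real \<Rightarrow> real" where
  "picard f 0 x t = 0"
| "picard f (Suc n) x t = exp (- Deg w m x * t) *
     (f x + integral {0..t} (\<lambda>s. exp (Deg w m x * s) * nbr_sum (\<lambda>y. picard f n y s) x))"

lemma picard_continuous: "continuous_on {0..T} (picard f n x)"
proof (induction n arbitrary: x)
  case (Suc n)
  have "continuous_on {0..T} (\<lambda>s. exp (Deg w m x * s) * nbr_sum (\<lambda>y. picard f n y s) x)"
    by (intro continuous_intros nbr_sum_continuous Suc)
  then have "continuous_on {0..T}
      (\<lambda>t. integral {0..t} (\<lambda>s. exp (Deg w m x * s) * nbr_sum (\<lambda>y. picard f n y s) x))"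
    by (intro indefinite_integral_continuous_1 integrable_continuous_real)
  then show ?case by (auto intro!: continuous_intros)
qed simp

lemma picard_integrable:
  "(\<lambda>s. exp (Deg w m x * s) * nbr_sum (\<lambda>y. picard f n y s) x) integrable_on {0..T}"
  by (intro integrable_continuous_real continuous_intros nbr_sum_continuous picard_continuous)

text \<open>For \<open>a = Deg w m x\<close> this is the Duhamel integral of the constant
  \<open>M\<close>. The factor \<open>a\<close> stays in the integrand so that \<open>a = 0\<close>,
  the one-vertex graph, is no separate case.\<close>

lemma exp_has_integral:
  fixes a M t :: real
  assumes "0 \<le> t"
  shows "((\<lambda>s. exp (a * s) * (a * M)) has_integral M * (exp (a * t) - 1)) {0..t}"
proof -
  have "((\<lambda>s. exp (a * s) * (a * M)) has_integral M * exp (a * t) - M * exp (a * 0)) {0..t}"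
    using assms
    by (intro fundamental_theorem_of_calculus)
      (auto simp: has_real_derivative_iff_has_vector_derivative[symmetric]
        intro!: derivative_eq_intros)
  then show ?thesis by (simp add: algebra_simps)
qed

text \<open>The Duhamel map preserves both bounds: \<open>nbr_sum\<close> is monotone, and the
  integral for the constant \<open>M\<close> adds to \<open>f x \<le> M\<close> to give at most
  \<open>M * exp (Deg w m x * t)\<close>.\<close>

lemma picard_bounds:
  assumes f: "\<And>x. 0 \<le> f x" "\<And>x. f x \<le> M" and "0 \<le> t"
  shows "0 \<le> picard f n x t \<and> picard f n x t \<le> M"
  using \<open>0 \<le> t\<close>
proof (induction n arbitrary: x t)
  case 0
  then show ?case using f[of x] by simp
next
  case (Suc n)
  let ?D = "Deg w m x"
  let ?h = "\<lambda>s. exp (?D * s) * nbr_sum (\<lambda>y. picard f n y s) x"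
  have nbr: "0 \<le> nbr_sum (\<lambda>y. picard f n y s) x" "nbr_sum (\<lambda>y. picard f n y s) x \<le> ?D * M"
    if "s \<in> {0..t}" for s
    using nbr_sum_mono[of "\<lambda>y. 0" "\<lambda>y. picard f n y s" x]
      nbr_sum_mono[of "\<lambda>y. picard f n y s" "\<lambda>y. M" x] Suc.IH[of s] that
    by (auto simp: nbr_sum_const)
  have "0 \<le> integral {0..t} ?h"
    using nbr by (intro integral_nonneg picard_integrable) auto
  moreover have "integral {0..t} ?h \<le> M * (exp (?D * t) - 1)"
    using exp_has_integral[OF Suc.prems, of ?D M] picard_integrable nbr
    by (intro has_integral_le[OF integrable_integral]) auto
  ultimately have "0 \<le> f x + integral {0..t} ?h" "f x + integral {0..t} ?h \<le> M * exp (?D * t)"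
    using f[of x] by (auto simp: algebra_simps)
  then have "0 \<le> exp (- ?D * t) * (f x + integral {0..t} ?h)"
    "exp (- ?D * t) * (f x + integral {0..t} ?h) \<le> exp (- ?D * t) * (M * exp (?D * t))"
    by (auto intro: mult_left_mono)
  then show ?case by (simp add: exp_minus field_simps)
qed

text \<open>The Duhamel map is order preserving, and the first iterate lies above the starting value
  0.\<close>

lemma picard_mono:
  assumes f: "\<And>x. 0 \<le> f x" "\<And>x. f x \<le> M" and "0 \<le> t"
  shows "picard f n x t \<le> picard f (Suc n) x t"
  using \<open>0 \<le> t\<close>
proof (induction n arbitrary: x t)
  case 0
  then show ?case using picard_bounds[where f = f and n = "Suc 0" and t = t and x = x, OF f] by simp
next
  case (Suc n)
  have "integral {0..t} (\<lambda>s. exp (Deg w m x * s) * nbr_sum (\<lambda>y. picard f n y s) x)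
      \<le> integral {0..t} (\<lambda>s. exp (Deg w m x * s) * nbr_sum (\<lambda>y. picard f (Suc n) y s) x)"
  proof (rule integral_le[OF picard_integrable picard_integrable])
    fix s assume "s \<in> {0..t}"
    then show "exp (Deg w m x * s) * nbr_sum (\<lambda>y. picard f n y s) x
        \<le> exp (Deg w m x * s) * nbr_sum (\<lambda>y. picard f (Suc n) y s) x"
      using Suc.IH[of s] by (intro mult_left_mono nbr_sum_mono) auto
  qed
  then show ?case
    unfolding picard.simps(2)[of f n] picard.simps(2)[of f "Suc n"]
    by (intro mult_left_mono add_left_mono) auto
qed

text \<open>Feller's construction: the iterates increase to a solution of the Duhamel (variation of
  constants) form of the heat equation.\<close>

lemma solution_exists_nonneg:
  assumes f: "\<And>x. 0 \<le> f x" "\<And>x. f x \<le> M"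
  shows "\<exists>u. solution f u \<and> (\<forall>x. \<forall>t\<ge>0. 0 \<le> u x t)"
proof -
  define u where "u x t = (SUP n. picard f n x t)" for x t
  have lim: "(\<lambda>n. picard f n x t) \<longlonglongrightarrow> u x t" if "0 \<le> t" for x t
    unfolding u_def using picard_bounds[OF f that] picard_mono[OF f that]
    by (intro LIMSEQ_incseq_SUP bdd_aboveI2[where M = M] incseq_SucI) auto
  have bounds: "0 \<le> u x t" "u x t \<le> M" if "0 \<le> t" for x t
    using picard_bounds[OF f that]
    by (auto intro: LIMSEQ_le_const[OF lim[OF that]] LIMSEQ_le_const2[OF lim[OF that]])
  define h where "h x s = exp (Deg w m x * s) * nbr_sum (\<lambda>y. u y s) x" for x s
  define hn where "hn n x s = exp (Deg w m x * s) * nbr_sum (\<lambda>y. picard f n y s) x" for n x s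
  have hn_int: "hn n x integrable_on {0..t}" for n x t
    unfolding hn_def by (rule picard_integrable)
  have dom_int: "(\<lambda>s. exp (Deg w m x * s) * (Deg w m x * M)) integrable_on {0..t}" for x t
    by (intro integrable_continuous_real continuous_intros)
  \<comment> \<open>A bound independent of \<open>n\<close>, for dominated convergence in the
    Duhamel integral.\<close>
  have dom: "norm (hn n x s) \<le> exp (Deg w m x * s) * (Deg w m x * M)" if "0 \<le> s" for n x s
  proof -
    have "0 \<le> nbr_sum (\<lambda>y. picard f n y s) x" "nbr_sum (\<lambda>y. picard f n y s) x \<le> Deg w m x * M"
      using nbr_sum_mono[of "\<lambda>y. 0" "\<lambda>y. picard f n y s" x]
        nbr_sum_mono[of "\<lambda>y. picard f n y s" "\<lambda>y. M" x] picard_bounds[OF f that]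
      by (auto simp: nbr_sum_const)
    then show ?thesis by (simp add: hn_def abs_mult)
  qed
  have hn_lim: "(\<lambda>n. hn n x s) \<longlonglongrightarrow> h x s" if "0 \<le> s" for x s
    unfolding hn_def h_def using that lim by (intro tendsto_mult tendsto_const nbr_sum_tendsto) auto
  have integrable: "h x integrable_on {0..t}"
    and integral_lim: "(\<lambda>n. integral {0..t} (hn n x)) \<longlonglongrightarrow> integral {0..t} (h x)" for x t
    using dominated_convergence[where f = "\<lambda>n. hn n x" and S = "{0..t}" and g = "h x",
        OF hn_int dom_int[of x]] dom[of _ _ x] hn_lim[of _ x] by auto
  have duhamel: "u x t = exp (- Deg w m x * t) * (f x + integral {0..t} (h x))" if "0 \<le> t" for x t
  proof (rule LIMSEQ_unique)
    show "(\<lambda>n. picard f (Suc n) x t) \<longlonglongrightarrow> u x t"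
      using lim[OF that] by (rule LIMSEQ_Suc)
    show "(\<lambda>n. picard f (Suc n) x t) \<longlonglongrightarrow> exp (- Deg w m x * t) * (f x + integral {0..t} (h x))"
      unfolding picard.simps hn_def[symmetric] by (intro tendsto_intros integral_lim)
  qed
  \<comment> \<open>Bootstrapping: integrability of \<open>h\<close> makes \<open>u\<close>
    continuous, hence \<open>h\<close> is continuous, and then the fundamental theorem of calculus
    differentiates the Duhamel formula.\<close>
  have "continuous_on {0..T} (\<lambda>t. exp (- Deg w m x * t) * (f x + integral {0..t} (h x)))" for x T
    by (intro continuous_intros indefinite_integral_continuous_1 integrable)
  then have cont: "continuous_on {0..T} (u x)" for x T
    by (rule continuous_on_eq) (simp add: duhamel)
  have h_cont: "continuous_on {0..T} (h x)" for x T
    unfolding h_def by (intro continuous_intros nbr_sum_continuous cont)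
  have deriv: "(u x has_real_derivative laplacian w m (\<lambda>y. u y t) x) (at t within {0..})"
    if "0 \<le> t" for x t
  proof -
    let ?D = "Deg w m x" and ?I = "\<lambda>t. integral {0..t} (h x)"
    have "((\<lambda>t. exp (- ?D * t) * (f x + ?I t)) has_real_derivative
        - ?D * exp (- ?D * t) * (f x + ?I t) + exp (- ?D * t) * h x t) (at t within {0..t+1})"
      using integral_has_real_derivative[OF h_cont, of t "t + 1" x] that
      by (auto intro!: derivative_eq_intros)
    also have "- ?D * exp (- ?D * t) * (f x + ?I t) + exp (- ?D * t) * h x t
        = laplacian w m (\<lambda>y. u y t) x"
    proof -
      have "exp (- ?D * t) * h x t = nbr_sum (\<lambda>y. u y t) x"
        by (simp add: h_def exp_minus)
      then show ?thesis
        unfolding laplacian_nbr_sum duhamel[OF that, of x] by simp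
    qed
    \<comment> \<open>The two intervals coincide near \<open>t\<close>.\<close>
    also have "at t within {0..t+1} = at t within {0..}"
      using that by (intro at_within_nhd[of t "{..<t+1}"]) auto
    finally show ?thesis
      by (rule has_field_derivative_transform_within[where d = 1]) (use that duhamel in auto)
  qed
  have "\<forall>x. \<forall>t\<ge>0. \<bar>u x t\<bar> \<le> M" using bounds by simp
  then have "solution f u"
    unfolding solution_def using deriv duhamel[of 0] by auto
  then show ?thesis using bounds by blast
qed

text \<open>Adding the constant \<open>M\<close>, itself a solution, reduces an \<open>f\<close> of
  arbitrary sign to the nonnegative case.\<close>

lemma solution_exists:
  assumes "\<And>x. \<bar>f x\<bar> \<le> M"
  shows "\<exists>u. solution f u"
proof -
  have "0 \<le> f x + M" "f x + M \<le> 2 * M" for x using assms[of x] by auto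
  then obtain u where "solution (\<lambda>x. f x + M) u"
    using solution_exists_nonneg[of "\<lambda>x. f x + M" "2 * M"] by blast
  from solution_diff[OF this solution_const[of M]] show ?thesis by auto
qed

end

subsection \<open>Curvature bounded below\<close>

locale ricci_graph = weighted_graph w m
  for w :: "'v::countable \<Rightarrow> 'v \<Rightarrow> real" and m +
  fixes K :: real
  assumes Ric: "Ric_ge w m K"
begin

text \<open>The form in which the lower curvature bound is used from here on.\<close>

lemma laplacian_contraction:
  assumes "x \<noteq> y" "f \<in> Lip1 w" "f x - f y = real (gdist w x y)"
  shows "laplacian w m f x - laplacian w m f y \<le> - K * real (gdist w x y)"
proof -
  have "K * real (gdist w x y) \<le> curvature w m x y * real (gdist w x y)"
    using Ric assms(1) by (intro mult_right_mono) (auto simp: Ric_ge_def)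
  then show ?thesis using curvature_le[OF assms] by simp
qed

section \<open>Distance barrier and uniqueness of bounded solutions\<close>

definition barrier :: "'v \<Rightarrow> 'v \<Rightarrow> real" where
  "barrier r z = 1 + real (gdist w z r)"

text \<open>\<open>Deg w m r\<close> bounds the Laplacian of the distance at the root,
  \<open>\<bar>K\<bar>\<close> its growth away from the root, and the 1 makes
  \<open>laplacian_barrier\<close> strict.\<close>

definition rate :: "'v \<Rightarrow> real" where
  "rate r = Deg w m r + \<bar>K\<bar> + 1"

lemma barrier_ge_1: "barrier r z \<ge> 1"
  by (simp add: barrier_def)

lemma rate_pos: "rate r > 0"
  using Deg_nonneg[of r] by (simp add: rate_def)

lemma finite_barrier: "finite {z. barrier r z \<le> R}"
proof -
  have "{z. barrier r z \<le> R} \<subseteq> {z. gdist w r z \<le> nat \<lceil>R\<rceil>}"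
    by (auto simp: barrier_def gdist_sym[of _ r]) linarith
  then show ?thesis using finite_gdist_ball by (rule finite_subset)
qed

text \<open>Laplacian comparison: the distance to \<open>r\<close> is extremal for the curvature of \<open>z\<close> and \<open>r\<close>.\<close>

lemma laplacian_barrier: "laplacian w m (barrier r) z < rate r * barrier r z"
proof -
  let ?f = "\<lambda>z. real (gdist w z r)"
  have "laplacian w m (barrier r) z = laplacian w m ?f z"
    unfolding barrier_def[abs_def] by (simp add: laplacian_add)
  also have "\<dots> \<le> Deg w m r + \<bar>K\<bar> * ?f z"
  proof (cases "z = r")
    case True
    then show ?thesis using laplacian_Lip1[OF gdist_Lip1[of r], of r] by simp
  next
    case False
    have "laplacian w m ?f z - laplacian w m ?f r \<le> - K * ?f z"
      using False gdist_Lip1 by (intro laplacian_contraction) auto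
    moreover have "- K * ?f z \<le> \<bar>K\<bar> * ?f z" by (intro mult_right_mono) auto
    moreover have "laplacian w m ?f r \<le> Deg w m r"
      using laplacian_Lip1[OF gdist_Lip1[of r], of r] by simp
    ultimately show ?thesis by linarith
  qed
  also have "\<dots> < rate r * barrier r z"
  proof -
    have "Deg w m r * 1 \<le> Deg w m r * barrier r z"
      using Deg_nonneg barrier_ge_1 by (intro mult_left_mono)
    moreover have "\<bar>K\<bar> * ?f z \<le> \<bar>K\<bar> * barrier r z"
      by (intro mult_left_mono) (auto simp: barrier_def)
    ultimately show ?thesis using barrier_ge_1[of r z] by (simp add: rate_def algebra_simps)
  qed
  finally show ?thesis .
qed

text \<open>The right-hand side is a strict supersolution by \<open>laplacian_barrier\<close> and
  dominates the bounded solution outside a finite set, so the maximum principle applies to the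
  difference.\<close>

lemma solution_le_barrier:
  assumes u: "solution f u" and "\<delta> > 0" and f: "\<And>z. f z \<le> \<delta> * barrier r z" and "0 \<le> t"
  shows "u x t \<le> \<delta> * exp (rate r * t) * barrier r x"
proof -
  obtain C where C: "\<And>z s. 0 \<le> s \<Longrightarrow> \<bar>u z s\<bar> \<le> C" using solution_bound[OF u] by blast
  let ?G = "\<lambda>z s. u z s - \<delta> * exp (rate r * s) * barrier r z"
  let ?G' = "\<lambda>z s. laplacian w m (\<lambda>y. u y s) z - \<delta> * (rate r * exp (rate r * s)) * barrier r z"
  have "?G x t \<le> 0"
  proof (rule parabolic_maximum_principle[where G = ?G and G' = ?G'])
    show "finite {z. barrier r z \<le> C / \<delta>}" by (rule finite_barrier)
    show "?G z s \<le> 0" if "z \<notin> {z. barrier r z \<le> C / \<delta>}" "0 \<le> s" for z s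
    proof -
      have "C \<le> \<delta> * 1 * barrier r z" using that \<open>\<delta> > 0\<close> by (simp add: field_simps)
      also have "\<dots> \<le> \<delta> * exp (rate r * s) * barrier r z"
        using \<open>\<delta> > 0\<close> rate_pos[of r] that barrier_ge_1[of r z]
        by (intro mult_right_mono mult_left_mono) auto
      finally show ?thesis using C[OF \<open>0 \<le> s\<close>, of z] by simp
    qed
    show "?G z 0 \<le> 0" for z using f[of z] solution_0[OF u] by simp
    show "(?G z has_real_derivative ?G' z s) (at s within {0..})" if "0 \<le> s" for z s
      using solution_deriv[OF u that, of z] by (auto intro!: derivative_eq_intros)
    show "?G' z s < 0" if max: "\<And>y. ?G y s \<le> ?G z s" for z s
    proof -
      let ?c = "\<delta> * exp (rate r * s)"
      \<comment> \<open>At a spatial maximum of \<open>?G\<close> the increments of \<open>u\<close>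
        are at most those of the barrier term.\<close>
      have "laplacian w m (\<lambda>y. u y s) z \<le> laplacian w m (\<lambda>y. ?c * barrier r y) z"
        by (rule laplacian_mono) (use max in \<open>simp add: algebra_simps\<close>)
      also have "\<dots> < ?c * (rate r * barrier r z)"
        unfolding laplacian_cmult using laplacian_barrier \<open>\<delta> > 0\<close> by (intro mult_strict_left_mono) auto
      finally show ?thesis by (simp add: algebra_simps)
    qed
  qed (fact \<open>0 \<le> t\<close>)
  then show ?thesis by simp
qed

text \<open>The difference of two solutions starts at 0, hence stays below every positive multiple
  of the growing barrier.\<close>

lemma solution_unique:
  assumes "solution f u" "solution f v" "0 \<le> t"
  shows "u x t = v x t"
proof -
  have le: "u x t \<le> v x t" if "solution f u" "solution f v" for u v
  proof (rule field_le_epsilon)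
    fix e :: real assume "e > 0"
    \<comment> \<open>Chosen so that the barrier bound with root \<open>x\<close>, taken at
      \<open>x\<close> and time \<open>t\<close>, equals \<open>e\<close>.\<close>
    define \<delta> where "\<delta> = e / (exp (rate x * t) * barrier x x)"
    have "\<delta> > 0" using \<open>e > 0\<close> by (simp add: \<delta>_def barrier_def)
    have \<delta>_barrier: "0 \<le> \<delta> * barrier x z" for z
      using \<open>\<delta> > 0\<close> by (simp add: barrier_def)
    have "u x t - v x t \<le> \<delta> * exp (rate x * t) * barrier x x"
      by (rule solution_le_barrier[OF solution_diff[OF that] \<open>\<delta> > 0\<close> _ \<open>0 \<le> t\<close>])
        (simp add: \<delta>_barrier)
    also have "\<dots> = e" by (simp add: \<delta>_def barrier_def)
    finally show "u x t \<le> v x t + e" by simp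
  qed
  show ?thesis using le[OF assms(1,2)] le[OF assms(2,1)] by simp
qed

section \<open>Lipschitz estimate along the heat flow\<close>

text \<open>The sup-convolution of \<open>a\<close> with \<open>c\<close> times the distance touches \<open>a\<close> from above at \<open>x\<close> and
  \<open>b\<close> from below (up to a constant) at \<open>y\<close>. It plays the role of an optimal coupling of the two
  random walks.\<close>

lemma laplacian_diff_at_max:
  assumes "c > 0" "x \<noteq> y" and bdd: "\<And>z. a z \<le> C"
    and max: "\<And>x' y'. a x' - b y' - c * real (gdist w x' y') \<le> a x - b y - c * real (gdist w x y)"
  shows "laplacian w m a x - laplacian w m b y \<le> - K * c * real (gdist w x y)"
proof -
  define \<phi> where "\<phi> z = (SUP x'. a x' - c * real (gdist w x' z))" for z
  define M where "M = a x - b y - c * real (gdist w x y)"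
  have ge: "a x' - c * real (gdist w x' z) \<le> \<phi> z" for x' z
    unfolding \<phi>_def
  proof (rule cSUP_upper)
    have "a x' - c * real (gdist w x' z) \<le> C" for x'
      using bdd[of x'] \<open>c > 0\<close> by (simp add: add_increasing2 algebra_simps)
    then show "bdd_above (range (\<lambda>x'. a x' - c * real (gdist w x' z)))" by (rule bdd_aboveI2)
  qed simp
  have le: "\<phi> z \<le> v" if "\<And>x'. a x' - c * real (gdist w x' z) \<le> v" for z v
    unfolding \<phi>_def using that by (intro cSUP_least) auto
  have lip: "\<phi> z \<le> \<phi> z' + c * real (gdist w z z')" for z z'
  proof (rule le)
    fix x'
    have "c * real (gdist w x' z') \<le> c * real (gdist w x' z + gdist w z z')"
      using gdist_triangle[of x' z' z] \<open>c > 0\<close> by (intro mult_left_mono) auto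
    then show "a x' - c * real (gdist w x' z) \<le> \<phi> z' + c * real (gdist w z z')"
      using ge[of x' z'] by (simp add: algebra_simps)
  qed
  have \<phi>_le: "\<phi> y' \<le> b y' + M" for y'
    by (rule le) (use max[of _ y'] in \<open>simp add: M_def algebra_simps\<close>)
  have \<phi>_y: "\<phi> y = b y + M"
    using \<phi>_le[of y] ge[of x y] by (simp add: M_def)
  have \<phi>_x: "\<phi> x = a x"
    using ge[of x x] lip[of x y] \<phi>_y by (simp add: M_def)
  have "laplacian w m a x \<le> laplacian w m \<phi> x"
    by (rule laplacian_mono) (use ge[of z z for z] \<phi>_x in simp)
  moreover have "laplacian w m \<phi> y \<le> laplacian w m b y"
  proof (rule laplacian_mono)
    fix z show "\<phi> z - \<phi> y \<le> b z - b y" using \<phi>_le[of z] \<phi>_y by simp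
  qed
  moreover have "laplacian w m \<phi> x - laplacian w m \<phi> y \<le> - K * c * real (gdist w x y)"
  proof -
    \<comment> \<open>Scaled by \<open>1 / c\<close>, the function \<open>\<phi>\<close> is
      1-Lipschitz and its increment from \<open>y\<close> to \<open>x\<close> is the full distance,
      so the curvature bound applies to it.\<close>
    let ?g = "\<lambda>z. (1 / c) * \<phi> z"
    have "?g \<in> Lip1 w"
    proof (rule Lip1_I)
      fix z z' show "?g z - ?g z' \<le> real (gdist w z z')"
        using lip[of z z'] \<open>c > 0\<close> by (simp add: field_simps)
    qed
    moreover have "?g x - ?g y = real (gdist w x y)"
      using \<phi>_x \<phi>_y \<open>c > 0\<close> by (simp add: M_def field_simps)
    ultimately have "laplacian w m ?g x - laplacian w m ?g y \<le> - K * real (gdist w x y)"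
      using \<open>x \<noteq> y\<close> by (intro laplacian_contraction)
    then show ?thesis using \<open>c > 0\<close> unfolding laplacian_cmult by (simp add: field_simps)
  qed
  ultimately show ?thesis by linarith
qed

text \<open>At a maximum over pairs, \<open>laplacian_diff_at_max\<close> gives a term
  \<open>- K * exp (- K * s) * d\<close> that cancels the time derivative of the Lipschitz bound.
  The barrier penalty confines the maximum to a finite set, supplies strictness, and is then removed
  by letting \<open>\<delta>\<close> tend to 0.\<close>

lemma solution_lipschitz:
  assumes u: "solution f u" and f: "f \<in> Lip1 w" and "0 \<le> t"
  shows "u x t - u y t \<le> exp (- K * t) * real (gdist w x y)"
proof -
  obtain C where C: "\<And>z s. 0 \<le> s \<Longrightarrow> \<bar>u z s\<bar> \<le> C" using solution_bound[OF u] by blast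
  have C0: "0 \<le> C" using C[of 0 x] by simp
  define r where "r = x"
  let ?b = "\<lambda>p. barrier r (fst p) + barrier r (snd p)" and ?d = "\<lambda>p. real (gdist w (fst p) (snd p))"
  have pen: "u x t - u y t - exp (- K * t) * real (gdist w x y) \<le> \<delta> * exp (rate r * t) * ?b (x, y)"
    if "\<delta> > 0" for \<delta>
  proof -
    let ?G = "\<lambda>p s. u (fst p) s - u (snd p) s - exp (- K * s) * ?d p - \<delta> * exp (rate r * s) * ?b p"
    let ?G' = "\<lambda>p s. laplacian w m (\<lambda>z. u z s) (fst p) - laplacian w m (\<lambda>z. u z s) (snd p)
        + K * exp (- K * s) * ?d p - \<delta> * (rate r * exp (rate r * s)) * ?b p"
    \<comment> \<open>The level is \<open>2 * C / \<delta>\<close> because a difference of two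
      values of \<open>u\<close> can reach \<open>2 * C\<close>.\<close>
    let ?B = "{z. barrier r z \<le> 2 * C / \<delta>}"
    have "?G (x, y) t \<le> 0"
    proof (rule parabolic_maximum_principle[where G = ?G and G' = ?G'])
      show "finite (?B \<times> ?B)" using finite_barrier by blast
      show "?G p s \<le> 0" if "p \<notin> ?B \<times> ?B" "0 \<le> s" for p s
      proof -
        have "2 * C / \<delta> \<le> ?b p"
          using that barrier_ge_1[of r "fst p"] barrier_ge_1[of r "snd p"]
          by (cases p) auto
        then have "2 * C \<le> \<delta> * 1 * ?b p" using \<open>\<delta> > 0\<close> by (simp add: field_simps)
        also have "\<dots> \<le> \<delta> * exp (rate r * s) * ?b p"
          using \<open>\<delta> > 0\<close> rate_pos[of r] that barrier_ge_1[of r "fst p"] barrier_ge_1[of r "snd p"]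
          by (intro mult_right_mono mult_left_mono) auto
        moreover have "0 \<le> exp (- K * s) * ?d p" by simp
        ultimately show ?thesis
          using C[OF \<open>0 \<le> s\<close>, of "fst p"] C[OF \<open>0 \<le> s\<close>, of "snd p"] by linarith
      qed
      show "?G p 0 \<le> 0" for p
      proof -
        have "0 \<le> \<delta> * ?b p"
          using \<open>\<delta> > 0\<close> barrier_ge_1[of r "fst p"] barrier_ge_1[of r "snd p"] by simp
        then show ?thesis using Lip1_D'[OF f, of "fst p" "snd p"] solution_0[OF u] by simp
      qed
      show "(?G p has_real_derivative ?G' p s) (at s within {0..})" if "0 \<le> s" for p s
        using solution_deriv[OF u that, of "fst p"] solution_deriv[OF u that, of "snd p"]
        by (auto intro!: derivative_eq_intros)
      show "?G' p s < 0" if "0 < s" "?G p s > 0" and max: "\<And>q. ?G q s \<le> ?G p s" for p s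
      proof -
        obtain x y where p: "p = (x, y)" by force
        let ?e = "\<delta> * exp (rate r * s)" and ?c = "exp (- K * s)"
        \<comment> \<open>Splitting the penalty between the two points brings the maximality of
          \<open>?G\<close> into the form required by \<open>laplacian_diff_at_max\<close>.\<close>
        let ?a = "\<lambda>z. u z s - ?e * barrier r z" and ?a' = "\<lambda>z. u z s + ?e * barrier r z"
        have "?e > 0" using \<open>\<delta> > 0\<close> by simp
        \<comment> \<open>On the diagonal only the negative penalty is left in
          \<open>?G\<close>.\<close>
        have "x \<noteq> y"
        proof
          assume "x = y"
          then have "?G p s = - (?e * ?b p)" using p by simp
          moreover have "?e * ?b p > 0"
            by (rule mult_pos_pos[OF \<open>?e > 0\<close>]) (simp add: barrier_def)
          ultimately show False using that(2) by linarith
        qed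
        have "laplacian w m ?a x - laplacian w m ?a' y \<le> - K * ?c * real (gdist w x y)"
        proof (rule laplacian_diff_at_max)
          show "?a z \<le> C" for z
          proof -
            have "0 \<le> ?e * barrier r z" using \<open>\<delta> > 0\<close> by (simp add: barrier_def)
            then show ?thesis using C[of s z] \<open>0 < s\<close> by linarith
          qed
          show "?a x' - ?a' y' - ?c * real (gdist w x' y') \<le> ?a x - ?a' y - ?c * real (gdist w x y)" for x' y'
            using max[of "(x', y')"] by (simp add: p algebra_simps)
        qed (use \<open>x \<noteq> y\<close> in auto)
        moreover have "?e * laplacian w m (barrier r) x < ?e * (rate r * barrier r x)"
          "?e * laplacian w m (barrier r) y < ?e * (rate r * barrier r y)"
          by (rule mult_strict_left_mono[OF laplacian_barrier \<open>?e > 0\<close>])+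
        ultimately show ?thesis
          unfolding laplacian_diff laplacian_add laplacian_cmult by (simp add: p algebra_simps)
      qed
    qed (fact \<open>0 \<le> t\<close>)
    then show ?thesis by simp
  qed
  have "u x t - u y t - exp (- K * t) * real (gdist w x y) \<le> 0 + e" if "e > 0" for e
  proof -
    \<comment> \<open>The coefficient of \<open>\<delta>\<close> in \<open>pen\<close>, so that
      \<open>\<delta> = e / B\<close> leaves exactly \<open>e\<close>.\<close>
    define B where "B = exp (rate r * t) * (barrier r x + barrier r y)"
    have "B > 0" unfolding B_def by (rule mult_pos_pos) (simp_all add: barrier_def)
    then show ?thesis using pen[of "e / B"] that by (simp add: mult.assoc B_def[symmetric])
  qed
  then have "u x t - u y t - exp (- K * t) * real (gdist w x y) \<le> 0" by (rule field_le_epsilon)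
  then show ?thesis by simp
qed

subsection \<open>The heat kernel\<close>

lemma heat_solution_imp_solution: "heat_solution w m f u \<Longrightarrow> solution f u"
  unfolding heat_solution_def solution_def by (auto simp: abs_of_nonneg)

text \<open>By uniqueness the nonnegative Feller solution is automatically the least one, so the
  \<open>SOME\<close> in \<open>heat_semigroup\<close> has a witness.\<close>

lemma solution_heat_semigroup:
  assumes "\<And>x. 0 \<le> f x" "\<And>x. f x \<le> M"
  shows "solution f (\<lambda>x t. heat_semigroup w m t f x)"
proof -
  obtain u where u: "solution f u" "\<And>x t. 0 \<le> t \<Longrightarrow> 0 \<le> u x t"
    using solution_exists_nonneg[of f M] assms by blast
  have "continuous_on {0..} (u x)" for x
    using solution_deriv[OF u(1)] by (intro DERIV_continuous_on) auto
  moreover have "\<exists>C. \<forall>x. \<forall>t\<ge>0. u x t \<le> C"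
    using solution_bound[OF u(1)] abs_le_D1 by metis
  ultimately have "heat_solution w m f u"
    unfolding heat_solution_def using u solution_deriv[OF u(1)] solution_0[OF u(1)] by auto
  moreover have "u x t \<le> v x t" if "heat_solution w m f v" "0 \<le> t" for v x t
    using solution_unique[OF u(1) heat_solution_imp_solution[OF that(1)] that(2), of x] by simp
  ultimately have "least_heat_solution w m f u"
    unfolding least_heat_solution_def by blast
  then have "least_heat_solution w m f (SOME u. least_heat_solution w m f u)"
    by (rule someI[where P = "least_heat_solution w m f"])
  then show ?thesis
    unfolding heat_semigroup_def least_heat_solution_def
    using heat_solution_imp_solution by blast
qed

lemma solution_heat_kernel: "solution (indicator {z}) (\<lambda>x t. heat_kernel w m t x z)"
  unfolding heat_kernel_def by (rule solution_heat_semigroup[where M = 1]) (auto simp: indicator_def)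

text \<open>The error made by restricting \<open>f\<close> to a ball is at most a small multiple of the barrier at time
  0, and remains so. In particular no mass escapes to infinity.\<close>

lemma has_sum_heat_kernel:
  assumes u: "solution f u" and f: "\<And>z. \<bar>f z\<bar> \<le> M" and "0 \<le> t"
  shows "((\<lambda>z. f z * heat_kernel w m t x z) has_sum u x t) UNIV"
  unfolding has_sum_def
proof (rule tendstoI)
  fix e :: real assume "e > 0"
  define \<delta> where "\<delta> = e / 2 / (exp (rate x * t) * barrier x x)"
  have "\<delta> > 0" using \<open>e > 0\<close> by (simp add: \<delta>_def barrier_def)
  have \<delta>_eq: "\<delta> * exp (rate x * t) * barrier x x = e / 2" by (simp add: \<delta>_def barrier_def)
  let ?B = "{z. barrier x z \<le> M / \<delta>}"
  have close: "dist (\<Sum>z\<in>Y. f z * heat_kernel w m t x z) (u x t) < e"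
    if Y: "finite Y" "?B \<subseteq> Y" for Y
  proof -
    \<comment> \<open>The part of \<open>f\<close> outside \<open>Y\<close>. By linearity
      \<open>?v\<close> solves the heat equation with these initial data, so the barrier bounds it
      from both sides.\<close>
    let ?g = "\<lambda>z. f z - (\<Sum>i\<in>Y. f i * indicator {i} z)"
    let ?v = "\<lambda>y s. u y s - (\<Sum>i\<in>Y. f i * heat_kernel w m s y i)"
    have v: "solution ?g ?v"
      by (intro solution_diff u solution_sum Y solution_cmult solution_heat_kernel)
    have g: "\<bar>?g z\<bar> \<le> \<delta> * barrier x z" for z
    proof (cases "z \<in> Y")
      case True
      then have "?g z = 0" using Y(1) by (simp add: indicator_def sum.delta)
      then show ?thesis using \<open>\<delta> > 0\<close> by (simp add: barrier_def)
    next
      case False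
      then have "?g z = f z" by (auto simp: indicator_def intro!: sum.neutral)
      moreover have "M / \<delta> \<le> barrier x z" using False Y(2) linear by blast
      then have "M \<le> \<delta> * barrier x z" using \<open>\<delta> > 0\<close> by (simp add: field_simps)
      ultimately show ?thesis using f[of z] by linarith
    qed
    have "?v x t \<le> \<delta> * exp (rate x * t) * barrier x x"
      using g by (intro solution_le_barrier[OF v \<open>\<delta> > 0\<close> _ \<open>0 \<le> t\<close>]) (simp add: abs_le_iff)
    moreover have "- 1 * ?v x t \<le> \<delta> * exp (rate x * t) * barrier x x"
      using g by (intro solution_le_barrier[OF solution_cmult[OF v] \<open>\<delta> > 0\<close> _ \<open>0 \<le> t\<close>])
        (simp add: abs_le_iff)
    ultimately show ?thesis using \<open>e > 0\<close> unfolding \<delta>_eq by (simp add: dist_real_def abs_less_iff)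
  qed
  show "\<forall>\<^sub>F Y in finite_subsets_at_top UNIV. dist (\<Sum>z\<in>Y. f z * heat_kernel w m t x z) (u x t) < e"
    unfolding eventually_finite_subsets_at_top
    using close finite_barrier by (intro exI[of _ ?B]) auto
qed

section \<open>Short-time comparison of the transport costs\<close>

lemma infsum_heat_kernel:
  assumes "solution f u" "\<And>z. \<bar>f z\<bar> \<le> M" "0 \<le> t"
  shows "(\<Sum>\<^sub>\<infinity>z\<in>UNIV. f z * (heat_kernel w m t x z - heat_kernel w m t y z)) = u x t - u y t"
  using has_sum_add[OF has_sum_heat_kernel[OF assms, of x]
      has_sum_uminusI[OF has_sum_heat_kernel[OF assms, of y]]]
  by (intro infsumI) (simp add: algebra_simps)

text \<open>The Lipschitz bound on the solution makes the error uniform over all initial data in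
  \<open>Lip1 w\<close>.\<close>

lemma short_time_expansion:
  "\<exists>C\<ge>0. \<forall>f u t. f \<in> Lip1 w \<longrightarrow> solution f u \<longrightarrow> 0 \<le> t \<longrightarrow> t \<le> 1 \<longrightarrow>
     \<bar>u x t - f x - t * laplacian w m f x\<bar> \<le> C * t\<^sup>2"
proof -
  \<comment> \<open>Bounds \<open>exp (- K * s)\<close> for all \<open>s\<close> in
    \<open>{0..1}\<close>.\<close>
  define c where "c = exp \<bar>K\<bar>"
  have "c > 0" by (simp add: c_def)
  \<comment> \<open>Collects the errors \<open>c * Deg w m z * s\<close> of \<open>u z s\<close> at
    \<open>x\<close> and its neighbours, weighted as in the Laplacian at \<open>x\<close>.\<close>
  define C where "C = (\<Sum>y\<in>nbrs x. w x y * (c * (Deg w m y + Deg w m x))) / m x"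
  have "C \<ge> 0"
    unfolding C_def using w_nonneg Deg_nonneg \<open>c > 0\<close> m_pos[of x]
    by (intro divide_nonneg_pos sum_nonneg mult_nonneg_nonneg add_nonneg_nonneg) auto
  moreover have "\<bar>u x t - f x - t * laplacian w m f x\<bar> \<le> C * t\<^sup>2"
    if f: "f \<in> Lip1 w" and u: "solution f u" and t: "0 \<le> t" "t \<le> 1" for f u t
  proof -
    have deriv: "(u z has_real_derivative laplacian w m (\<lambda>y. u y r) z) (at r within {0..s})"
      if "r \<in> {0..s}" for z r s
      using solution_deriv[OF u, of r z] that by (auto intro: DERIV_subset)
    have lip: "\<bar>u y s - u z s\<bar> \<le> c * real (gdist w y z)" if s: "0 \<le> s" "s \<le> 1" for y z s
    proof -
      have "- K * s \<le> \<bar>K\<bar> * s" using s by (intro mult_right_mono) auto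
      also have "\<dots> \<le> \<bar>K\<bar>" using s by (intro mult_left_le) auto
      finally have "exp (- K * s) * real (gdist w y z) \<le> c * real (gdist w y z)"
        unfolding c_def by (intro mult_right_mono) auto
      then show ?thesis
        using solution_lipschitz[OF u f \<open>0 \<le> s\<close>, of y z] solution_lipschitz[OF u f \<open>0 \<le> s\<close>, of z y]
        by (simp add: gdist_sym[of z y] abs_le_iff)
    qed
    have near: "\<bar>u z s - f z\<bar> \<le> c * Deg w m z * s" if s: "0 \<le> s" "s \<le> 1" for z s
    proof -
      have "norm (u z s - u z 0) \<le> c * Deg w m z * norm (s - 0)"
      proof (rule field_differentiable_bound)
        show "(u z has_field_derivative laplacian w m (\<lambda>y. u y r) z) (at r within {0..s})"
          if "r \<in> {0..s}" for r using that by (rule deriv)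
        show "norm (laplacian w m (\<lambda>y. u y r) z) \<le> c * Deg w m z" if "r \<in> {0..s}" for r
          using laplacian_lipschitz[OF lip, of r z] that s by simp
      qed (use s in auto)
      then show ?thesis using s solution_0[OF u] by simp
    qed
    have lap: "\<bar>laplacian w m (\<lambda>y. u y s) x - laplacian w m f x\<bar> \<le> C * s" if s: "0 \<le> s" "s \<le> 1" for s
    proof -
      have "\<bar>laplacian w m (\<lambda>y. u y s - f y) x\<bar>
          \<le> (\<Sum>y\<in>nbrs x. w x y * (c * (Deg w m y + Deg w m x) * s)) / m x"
      proof (rule laplacian_abs_le)
        fix y
        show "\<bar>u y s - f y - (u x s - f x)\<bar> \<le> c * (Deg w m y + Deg w m x) * s"
          using near[OF s, of y] near[OF s, of x] by (simp add: algebra_simps)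
      qed
      also have "\<dots> = C * s"
        by (simp add: C_def sum_distrib_right mult.assoc)
      finally show ?thesis by (simp add: laplacian_diff)
    qed
    \<comment> \<open>Without its linear part \<open>u x\<close> has derivative at most
      \<open>C * t\<close> in absolute value on \<open>{0..t}\<close>; the mean value inequality
      yields the second factor \<open>t\<close>.\<close>
    let ?g = "\<lambda>s. u x s - s * laplacian w m f x"
    have "norm (?g t - ?g 0) \<le> C * t * norm (t - 0)"
    proof (rule field_differentiable_bound)
      show "(?g has_field_derivative laplacian w m (\<lambda>y. u y r) x - laplacian w m f x) (at r within {0..t})"
        if "r \<in> {0..t}" for r
        using deriv[OF that, of x] by (auto intro!: derivative_eq_intros)
      show "norm (laplacian w m (\<lambda>y. u y r) x - laplacian w m f x) \<le> C * t" if "r \<in> {0..t}" for r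
        using lap[of r] mult_left_mono[of r t C] \<open>C \<ge> 0\<close> that t by simp
    qed (use t in auto)
    then show ?thesis
      using t by (simp add: solution_0[OF u] power2_eq_square algebra_simps)
  qed
  ultimately show ?thesis by blast
qed

text \<open>Both distances are suprema over the same test functions, and the objectives differ by at
  most \<open>C * t\<^sup>2\<close> uniformly, so the suprema do too. This also makes the distance
  of the heat kernels finite.\<close>

lemma wasserstein_heat_kernel:
  "\<exists>C. \<forall>t. 0 \<le> t \<longrightarrow> t \<le> 1 \<longrightarrow>
     (\<exists>c. wasserstein w (heat_kernel w m t x) (heat_kernel w m t y) = ereal c \<and>
       \<bar>c - walk_cost x y t\<bar> \<le> C * t\<^sup>2)"
proof -
  obtain A where A: "\<And>f u t. f \<in> Lip1 w \<Longrightarrow> solution f u \<Longrightarrow> 0 \<le> t \<Longrightarrow> t \<le> 1 \<Longrightarrow>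
     \<bar>u x t - f x - t * laplacian w m f x\<bar> \<le> A * t\<^sup>2"
    using short_time_expansion[of x] by blast
  obtain B where B: "\<And>f u t. f \<in> Lip1 w \<Longrightarrow> solution f u \<Longrightarrow> 0 \<le> t \<Longrightarrow> t \<le> 1 \<Longrightarrow>
     \<bar>u y t - f y - t * laplacian w m f y\<bar> \<le> B * t\<^sup>2"
    using short_time_expansion[of y] by blast
  define C where "C = A + B"
  have "\<exists>c. wasserstein w (heat_kernel w m t x) (heat_kernel w m t y) = ereal c \<and>
      \<bar>c - walk_cost x y t\<bar> \<le> C * t\<^sup>2" if t: "0 \<le> t" "t \<le> 1" for t
  proof -
    let ?W = "wasserstein w (heat_kernel w m t x) (heat_kernel w m t y)"
    let ?S = "\<lambda>f. \<Sum>\<^sub>\<infinity>z\<in>UNIV. f z * (heat_kernel w m t x z - heat_kernel w m t y z)"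
    let ?T = "\<lambda>f. f x - f y + t * (laplacian w m f x - laplacian w m f y)"
    have near: "\<bar>?S f - ?T f\<bar> \<le> C * t\<^sup>2" if "f \<in> bounded_Lip1" for f
    proof -
      from that obtain M where f: "f \<in> Lip1 w" "\<And>z. \<bar>f z\<bar> \<le> M"
        unfolding bounded_Lip1_def by (auto simp: bounded_iff)
      \<comment> \<open>Since \<open>f\<close> may take negative values, its evolution is a bounded
        \<open>solution\<close> rather than \<open>heat_semigroup\<close>.\<close>
      obtain u where u: "solution f u" using solution_exists[where f = f, OF f(2)] by blast
      have "?S f = u x t - u y t" using infsum_heat_kernel[OF u f(2) t(1)] .
      then show ?thesis
        using A[OF f(1) u t] B[OF f(1) u t] by (simp add: C_def algebra_simps)
    qed
    have W: "?W = (SUP f\<in>bounded_Lip1. ereal (?S f))"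
      by (simp add: wasserstein_def bounded_Lip1_def)
    have upper: "?W \<le> ereal (walk_cost x y t + C * t\<^sup>2)"
      unfolding W
    proof (rule SUP_least)
      fix f assume "f \<in> bounded_Lip1"
      then show "ereal (?S f) \<le> ereal (walk_cost x y t + C * t\<^sup>2)"
        using near[of f] walk_cost_ge[OF t(1), of f x y] by simp
    qed
    have S_le: "ereal (?S f) \<le> ?W" if "f \<in> bounded_Lip1" for f
      unfolding W using that by (rule SUP_upper)
    have "\<bar>?W\<bar> \<noteq> \<infinity>"
      using upper S_le[OF zero_bounded_Lip1] by auto
    then obtain c where c: "?W = ereal c" by auto
    have "walk_cost x y t \<le> c + C * t\<^sup>2"
      unfolding walk_cost_def
    proof (rule cSUP_least)
      fix f assume f: "f \<in> bounded_Lip1"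
      show "?T f \<le> c + C * t\<^sup>2" using S_le[OF f] near[OF f] by (simp add: c)
    qed (use zero_bounded_Lip1 in blast)
    then show ?thesis using upper c by (intro exI[of _ c]) (simp add: abs_le_iff)
  qed
  then show ?thesis by blast
qed

text \<open>The difference quotients of the heat kernels and of the lazy walks differ by
  \<open>O(t)\<close>, so they share the limit \<open>curvature w m x y\<close>.\<close>

lemma heat_kernel_curvature:
  assumes "x \<noteq> y"
  shows "((\<lambda>t. ereal (1 / t) *
            (1 - wasserstein w (heat_kernel w m t x) (heat_kernel w m t y) / ereal (real (gdist w x y))))
          \<longlongrightarrow> ereal (curvature w m x y)) (at_right 0)"
proof -
  define d where "d = real (gdist w x y)"
  have "d > 0" using gdist_pos[OF assms] by (simp add: d_def)
  obtain C c where c: "\<And>t. 0 \<le> t \<Longrightarrow> t \<le> 1 \<Longrightarrow>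
      wasserstein w (heat_kernel w m t x) (heat_kernel w m t y) = ereal (c t)"
    "\<And>t. 0 \<le> t \<Longrightarrow> t \<le> 1 \<Longrightarrow> \<bar>c t - walk_cost x y t\<bar> \<le> C * t\<^sup>2"
    using wasserstein_heat_kernel[of x y] by metis
  let ?p = "\<lambda>t. (1 - c t / d) / t" and ?q = "\<lambda>t. (1 - walk_cost x y t / d) / t"
  have small: "\<forall>\<^sub>F t in at_right 0. t \<in> {0<..<1::real}"
    by (rule eventually_at_right_real) simp
  have "((\<lambda>t. ?p t - ?q t) \<longlongrightarrow> 0) (at_right 0)"
  proof (rule Lim_null_comparison)
    show "\<forall>\<^sub>F t in at_right 0. norm (?p t - ?q t) \<le> C * t / d"
      using small
    proof eventually_elim
      case (elim t)
      have "?p t - ?q t = - (c t - walk_cost x y t) / (d * t)"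
        using elim \<open>d > 0\<close> by (simp add: field_simps)
      then have "norm (?p t - ?q t) = \<bar>c t - walk_cost x y t\<bar> / (d * t)"
        using elim \<open>d > 0\<close> by (simp add: abs_mult)
      also have "\<dots> \<le> C * t\<^sup>2 / (d * t)"
        using elim \<open>d > 0\<close> c(2)[of t] by (intro divide_right_mono) auto
      also have "\<dots> = C * t / d"
        using elim by (simp add: power2_eq_square)
      finally show ?case .
    qed
    show "((\<lambda>t. C * t / d) \<longlongrightarrow> 0) (at_right 0)"
      using \<open>d > 0\<close> by (auto intro!: tendsto_eq_intros)
  qed
  from tendsto_add[OF this walk_cost_tendsto_curvature[OF assms, folded d_def]]
  have "(?p \<longlongrightarrow> curvature w m x y) (at_right 0)" by simp
  then have "((\<lambda>t. ereal (?p t)) \<longlongrightarrow> ereal (curvature w m x y)) (at_right 0)" by simp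
  then show ?thesis
  proof (rule Lim_transform_eventually)
    show "\<forall>\<^sub>F t in at_right 0. ereal (?p t) = ereal (1 / t) *
        (1 - wasserstein w (heat_kernel w m t x) (heat_kernel w m t y) / ereal (real (gdist w x y)))"
      using small
    proof eventually_elim
      case (elim t)
      then show ?case
        using c(1)[of t] \<open>d > 0\<close> by (simp add: d_def[symmetric] one_ereal_def)
    qed
  qed
qed

end

theorem corollary5p9:
  fixes w :: "'v::countable \<Rightarrow> 'v \<Rightarrow> real" and m :: "'v \<Rightarrow> real" and K :: real and x y :: 'v
  assumes "weighted_graph w m"
    and "Ric_ge w m K"
    and "x \<noteq> y"
  shows "((\<lambda>t. ereal (1 / t) *
            (1 - wasserstein w (heat_kernel w m t x) (heat_kernel w m t y) / ereal (real (gdist w x y))))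
          \<longlongrightarrow> ereal (curvature w m x y)) (at_right 0)"
proof -
  interpret ricci_graph w m K
    using assms(1,2) by (simp add: ricci_graph_def ricci_graph_axioms_def)
  show ?thesis using assms(3) by (rule heat_kernel_curvature)
qed

end
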